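(* For every constant $C$ there exist an integer $k\geq 1$ and a finite simple graph with minimum degree at least $k+C\sqrt{k}$ that has no $(k+1)$-edge-connected subgraph.
   Context: A graph $H$ is $(k+1)$-edge-connected if it has at least two vertices and for every partition of $V(H)$ into two nonempty sets, at least $k+1$ edges join the two sets. *)

theory Defs
  imports Complex_Main "Graph_Theory.Graph_Theory"
begin

text \<open>
  A finite simple graph is a \<^locale>\<open>pair_graph\<close>: finitely many vertices, no loops, and a
  symmetric arc set consisting of pairs of vertices. The undirected edge \<open>uv\<close> is represented by the
  two arcs \<open>(u, v)\<close> and \<open>(v, u)\<close>, so the degree of \<open>v\<close> is its out-degree, and the undirected
  edges joining two disjoint vertex sets \<open>A\<close> and \<open>B\<close> correspond one-to-one to the arcs
  leading from \<open>A\<close> to \<open>B\<close>.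
\<close>

text \<open>Only meaningful for a finite graph with at least one vertex.\<close>

definition min_degree :: "'a pair_pre_digraph \<Rightarrow> nat" where
  "min_degree G = Min (out_degree (with_proj G) ` pverts G)"

definition edges_between :: "'a pair_pre_digraph \<Rightarrow> 'a set \<Rightarrow> 'a set \<Rightarrow> ('a \<times> 'a) set" where
  "edges_between G A B = {e \<in> parcs G. fst e \<in> A \<and> snd e \<in> B}"

definition edge_connected :: "nat \<Rightarrow> 'a pair_pre_digraph \<Rightarrow> bool" where
  "edge_connected l H \<longleftrightarrow>
     card (pverts H) \<ge> 2 \<and>
     (\<forall>A B. A \<noteq> {} \<and> B \<noteq> {} \<and> A \<inter> B = {} \<and> A \<union> B = pverts H
        \<longrightarrow> card (edges_between H A B) \<ge> l)"

end

theory Submission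
  imports Defs
begin

text \<open>
  It suffices to build a graph in which every vertex set of size at least 2 splits along at most
  \<open>k\<close> edges. Put \<open>k = 2 L q\<^sup>2\<close> with \<open>L = 2 c\<^sup>2\<close>, so that \<open>c \<surd>k = L q\<close>. Start from a clique on
  \<open>k\<close> vertices completely joined to \<open>L q + 1\<close> independent ports; the ports have degree only \<open>k\<close>, all
  other vertices have degree \<open>k + L q\<close>. In step \<open>j + 1\<close>, add \<open>q\<close> hubs, each joined to the same
  \<open>k\<close> vertices including all ports, so that every port gains \<open>q\<close>. Then take two copies and join
  each hub to \<open>(j + 1) q\<close> vertices of the other copy, so that the hubs catch up with the ports; this
  uses \<open>2 q (j + 1) q \<le> k\<close> edges. The copies can thus be cut apart, and then the hubs peel off one by
  one. After \<open>L\<close> steps the ports have degree \<open>k + L q\<close>. There are never more than about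
  \<open>2^L (L + 3) q\<close> ports, which is at most \<open>k\<close> for large \<open>q\<close>, since \<open>L\<close> depends only on \<open>c\<close>.
\<close>

section \<open>Vertex sets that split along few edges\<close>

definition neighbours :: "('a \<Rightarrow> 'a \<Rightarrow> bool) \<Rightarrow> 'a set \<Rightarrow> 'a \<Rightarrow> 'a set" where
  "neighbours E V v = {u \<in> V. E v u}"

definition crossing :: "('a \<Rightarrow> 'a \<Rightarrow> bool) \<Rightarrow> 'a set \<Rightarrow> 'a set \<Rightarrow> ('a \<times> 'a) set" where
  "crossing E A B = {(a, b). a \<in> A \<and> b \<in> B \<and> E a b}"

text \<open>Quantifying over vertex sets covers all subgraphs, induced or not, because deleting
  edges only shrinks a cut. Bounds for \<open>k\<close> thus rule out (k+1)-edge-connected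
  subgraphs.\<close>

definition separable :: "nat \<Rightarrow> ('a \<Rightarrow> 'a \<Rightarrow> bool) \<Rightarrow> 'a set \<Rightarrow> bool" where
  "separable k E V \<longleftrightarrow>
     (\<forall>S\<subseteq>V. card S \<ge> 2 \<longrightarrow>
        (\<exists>A B. A \<noteq> {} \<and> B \<noteq> {} \<and> A \<inter> B = {} \<and> A \<union> B = S \<and> card (crossing E A B) \<le> k))"

lemma neighbours_subset: "neighbours E V v \<subseteq> V"
  by (auto simp: neighbours_def)

lemma finite_neighbours [simp]: "finite V \<Longrightarrow> finite (neighbours E V v)"
  by (simp add: neighbours_def)

lemma crossing_subset: "crossing E A B \<subseteq> A \<times> B"
  by (auto simp: crossing_def)

lemma crossing_mono: "A \<subseteq> A' \<Longrightarrow> B \<subseteq> B' \<Longrightarrow> crossing E A B \<subseteq> crossing E A' B'"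
  by (auto simp: crossing_def)

lemma finite_crossing: "finite A \<Longrightarrow> finite B \<Longrightarrow> finite (crossing E A B)"
  by (rule finite_subset[OF crossing_subset]) simp

lemma separable_empty: "separable k E {}"
  by (simp add: separable_def)

lemma separable_cong:
  assumes "\<And>u v. u \<in> V \<Longrightarrow> v \<in> V \<Longrightarrow> E u v = E' u v"
  shows "separable k E V \<longleftrightarrow> separable k E' V"
proof -
  have "crossing E A B = crossing E' A B" if "A \<union> B \<subseteq> V" for A B
    using assms that by (auto simp: crossing_def)
  then show ?thesis
    unfolding separable_def by (intro all_cong1 imp_cong ex_cong1 conj_cong refl) auto
qed

text \<open>A set contained in neither part is cut into \<open>S \<inter> V\<close> and
  \<open>S - V\<close>, and the edges between these are among those from \<open>V\<close> to
  \<open>V'\<close>.\<close>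

lemma separable_Un:
  assumes "separable k E V" "separable k E V'" "finite V" "finite V'"
    and "card (crossing E V V') \<le> k"
  shows "separable k E (V \<union> V')"
  unfolding separable_def
proof (intro allI impI)
  fix S assume S: "S \<subseteq> V \<union> V'" "card S \<ge> 2"
  show "\<exists>A B. A \<noteq> {} \<and> B \<noteq> {} \<and> A \<inter> B = {} \<and> A \<union> B = S \<and> card (crossing E A B) \<le> k"
  proof (cases "S \<subseteq> V \<or> S \<subseteq> V'")
    case True
    then show ?thesis
      using assms(1,2) S(2) unfolding separable_def by blast
  next
    case False
    have "card (crossing E (S \<inter> V) (S - V)) \<le> card (crossing E V V')"
      using assms(3,4) S(1) by (intro card_mono finite_crossing crossing_mono) auto
    then show ?thesis
      using False S(1) assms(5)
      by (intro exI[of _ "S \<inter> V"] exI[of _ "S - V"]) auto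
  qed
qed

text \<open>Peeling: a set that meets \<open>P\<close> loses a single vertex of \<open>P\<close>,
  which costs at most its degree; all other sets lie in \<open>V\<close>.\<close>

lemma separable_extend:
  assumes V: "separable k E V" and fin: "finite V" "finite P"
    and deg: "\<And>p. p \<in> P \<Longrightarrow> card (neighbours E (V \<union> P) p) \<le> k"
  shows "separable k E (V \<union> P)"
  unfolding separable_def
proof (intro allI impI)
  fix S assume S: "S \<subseteq> V \<union> P" "card S \<ge> 2"
  show "\<exists>A B. A \<noteq> {} \<and> B \<noteq> {} \<and> A \<inter> B = {} \<and> A \<union> B = S \<and> card (crossing E A B) \<le> k"
  proof (cases "S \<subseteq> V")
    case True
    then show ?thesis using V S(2) unfolding separable_def by blast
  next
    case False
    then obtain p where p: "p \<in> S" "p \<in> P" using S(1) by auto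
    have "crossing E {p} (S - {p}) \<subseteq> Pair p ` neighbours E (V \<union> P) p"
      using S(1) by (auto simp: crossing_def neighbours_def)
    then have "card (crossing E {p} (S - {p})) \<le> card (neighbours E (V \<union> P) p)"
      using fin by (intro surj_card_le) auto
    moreover have "S \<noteq> {p}" using S(2) by auto
    ultimately show ?thesis
      using p deg[of p] by (intro exI[of _ "{p}"] exI[of _ "S - {p}"]) auto
  qed
qed

lemma separable_image:
  assumes V: "separable k E V" and fin: "finite V" and inj: "inj_on f V"
    and E: "\<And>u v. u \<in> V \<Longrightarrow> v \<in> V \<Longrightarrow> E' (f u) (f v) = E u v"
  shows "separable k E' (f ` V)"
  unfolding separable_def
proof (intro allI impI)
  fix S assume S: "S \<subseteq> f ` V" "card S \<ge> 2"
  then obtain T where T: "T \<subseteq> V" "S = f ` T" by (meson subset_imageE)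
  then have "card S = card T" using inj by (metis card_image inj_on_subset)
  then obtain A B where AB: "A \<noteq> {}" "B \<noteq> {}" "A \<inter> B = {}" "A \<union> B = T"
      "card (crossing E A B) \<le> k"
    using V S(2) T(1) unfolding separable_def by metis
  have "crossing E' (f ` A) (f ` B) \<subseteq> map_prod f f ` crossing E A B"
    using AB(4) T(1) E by (fastforce simp: crossing_def)
  moreover have "finite (crossing E A B)"
    using AB(4) T(1) fin by (intro finite_crossing) (auto intro: finite_subset)
  ultimately have "card (crossing E' (f ` A) (f ` B)) \<le> k"
    using AB(5) surj_card_le le_trans by blast
  moreover have "f ` A \<inter> f ` B = {}"
    using inj AB(3,4) T(1) by (metis inj_on_image_Int image_empty le_sup_iff)
  ultimately show "\<exists>A B. A \<noteq> {} \<and> B \<noteq> {} \<and> A \<inter> B = {} \<and> A \<union> B = S \<and> card (crossing E' A B) \<le> k"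
    using AB T(2) by (intro exI[of _ "f ` A"] exI[of _ "f ` B"]) auto
qed

section \<open>Attaching hubs\<close>

text \<open>The old relation is restricted to \<open>V\<close> because \<open>E\<close> may also
  hold outside \<open>V\<close>, where the fresh vertices \<open>P\<close> are taken. The hubs
  \<open>P\<close> are therefore independent and see only \<open>W\<close>.\<close>

definition attach :: "('a \<Rightarrow> 'a \<Rightarrow> bool) \<Rightarrow> 'a set \<Rightarrow> 'a set \<Rightarrow> 'a set \<Rightarrow> 'a \<Rightarrow> 'a \<Rightarrow> bool" where
  "attach E V P W u v \<longleftrightarrow>
     u \<in> V \<and> v \<in> V \<and> E u v \<or> u \<in> P \<and> v \<in> W \<or> u \<in> W \<and> v \<in> P"

lemma attach_neighbours:
  assumes "V \<inter> P = {}" "W \<subseteq> V"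
  shows "p \<in> P \<Longrightarrow> neighbours (attach E V P W) (V \<union> P) p = W"
    and "v \<in> W \<Longrightarrow> neighbours (attach E V P W) (V \<union> P) v = neighbours E V v \<union> P"
    and "v \<in> V - W \<Longrightarrow> neighbours (attach E V P W) (V \<union> P) v = neighbours E V v"
  using assms by (auto simp: neighbours_def attach_def)

lemma separable_attach:
  assumes "separable k E V" "finite V" "finite P" "V \<inter> P = {}" "W \<subseteq> V" "card W \<le> k"
  shows "separable k (attach E V P W) (V \<union> P)"
proof (rule separable_extend)
  show "separable k (attach E V P W) V"
    using assms separable_cong[of V "attach E V P W" E k] by (auto simp: attach_def)
qed (use assms attach_neighbours(1)[of V P W] in auto)

section \<open>Joining two copies\<close>

text \<open>Vertex \<open>v\<close> of copy \<open>b\<close>, with \<open>b\<close> equal to \<open>0\<close> or \<open>1\<close>, is encoded as \<open>2 * v + b\<close>.\<close>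

definition doubled :: "(nat \<Rightarrow> nat \<Rightarrow> bool) \<Rightarrow> nat set \<Rightarrow> nat set \<Rightarrow> nat \<Rightarrow> nat \<Rightarrow> bool" where
  "doubled E P U x y \<longleftrightarrow>
     (if x mod 2 = y mod 2 then E (x div 2) (y div 2)
      else x div 2 \<in> P \<and> y div 2 \<in> U \<or> x div 2 \<in> U \<and> y div 2 \<in> P)"

definition copies :: "nat set \<Rightarrow> nat set" where
  "copies V = (\<lambda>v. 2 * v) ` V \<union> (\<lambda>v. 2 * v + 1) ` V"

lemma mem_copies [simp]: "x \<in> copies V \<longleftrightarrow> x div 2 \<in> V"
proof
  assume "x div 2 \<in> V"
  then show "x \<in> copies V"
    by (cases "even x") (auto simp: copies_def elim!: evenE oddE)
qed (auto simp: copies_def)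

lemma finite_copies [simp]: "finite V \<Longrightarrow> finite (copies V)"
  by (simp add: copies_def)

lemma card_copies:
  assumes "finite V"
  shows "card (copies V) = 2 * card V"
proof -
  have "(\<lambda>v. 2 * v) ` V \<inter> (\<lambda>v. 2 * v + 1) ` V = {}" 
    by (auto; presburger)
  then show ?thesis
    unfolding copies_def using assms by (subst card_Un_disjoint) (auto simp: card_image inj_on_def)
qed

text \<open>Each copy inherits separability from \<open>V\<close>. An edge between the copies has
  one end in \<open>P\<close> and the other in \<open>U\<close>, which gives at most
  \<open>2 * (card P * card U)\<close> of them.\<close>

lemma separable_doubled:
  assumes V: "separable k E V" "finite V" and PU: "P \<subseteq> V" "U \<subseteq> V" "2 * (card P * card U) \<le> k"
  shows "separable k (doubled E P U) (copies V)"
  unfolding copies_def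
proof (rule separable_Un)
  let ?V0 = "(\<lambda>v. 2 * v) ` V" and ?V1 = "(\<lambda>v. 2 * v + 1) ` V"
  show "separable k (doubled E P U) ?V0" "separable k (doubled E P U) ?V1"
    by (rule separable_image[OF V]; auto simp: inj_on_def doubled_def)+
  let ?f = "map_prod (\<lambda>v. 2 * v) (\<lambda>v. 2 * v + 1 :: nat)"
  have fin: "finite P" "finite U" using PU V(2) by (auto intro: finite_subset)
  have "crossing (doubled E P U) ?V0 ?V1 \<subseteq> ?f ` (P \<times> U \<union> U \<times> P)"
    by (auto simp: crossing_def doubled_def)
  then have "card (crossing (doubled E P U) ?V0 ?V1) \<le> card (P \<times> U \<union> U \<times> P)"
    using fin by (intro surj_card_le) auto
  also have "\<dots> \<le> card (P \<times> U) + card (U \<times> P)" by (rule card_Un_le)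
  also have "\<dots> \<le> k" using PU(3) by (simp add: card_cartesian_product mult.commute)
  finally show "card (crossing (doubled E P U) ?V0 ?V1) \<le> k" .
qed (use V in auto)

lemma card_neighbours_doubled:
  assumes "finite V"
  shows "card (neighbours E V (x div 2)) \<le> card (neighbours (doubled E P U) (copies V) x)"
proof -
  have "(\<lambda>u. 2 * u + x mod 2) ` neighbours E V (x div 2) \<subseteq> neighbours (doubled E P U) (copies V) x"
    by (auto simp: neighbours_def doubled_def)
  from card_mono[OF _ this] show ?thesis
    using assms by (simp add: card_image inj_on_def)
qed

text \<open>The neighbours inherited from \<open>E\<close> have the parity of \<open>x\<close>,
  those from \<open>U\<close> the opposite parity, so the two counts add up.\<close>

lemma card_neighbours_doubled_hub:
  assumes "finite V" "U \<subseteq> V" "x div 2 \<in> P"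
  shows "card (neighbours E V (x div 2)) + card U
     \<le> card (neighbours (doubled E P U) (copies V) x)"
proof -
  let ?A = "(\<lambda>u. 2 * u + x mod 2) ` neighbours E V (x div 2)"
  let ?B = "(\<lambda>u. 2 * u + (1 - x mod 2)) ` U"
  have fin: "finite U" using assms by (auto intro: finite_subset)
  have sub: "?A \<union> ?B \<subseteq> neighbours (doubled E P U) (copies V) x"
    using assms(2,3) by (cases "even x") (auto simp: neighbours_def doubled_def mod_2_eq_odd)
  have "?A \<inter> ?B = {}"
    by (cases "even x") (auto simp: mod_2_eq_odd; presburger)+
  then have "card (?A \<union> ?B) = card ?A + card ?B"
    using assms(1) fin by (intro card_Un_disjoint) auto
  moreover have "card ?A = card (neighbours E V (x div 2))" "card ?B = card U"
    by (rule card_image; auto simp: inj_on_def mod_2_eq_odd)+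
  ultimately show ?thesis
    using card_mono[OF _ sub] assms(1) by simp
qed

section \<open>Raising the port degrees step by step\<close>

text \<open>\<open>X\<close> holds the ports, whose degrees may still lag behind the target
  \<open>b\<close>. The bound \<open>k \<le> card V\<close> leaves room for the neighbourhoods of
  new hubs.\<close>

definition gadget ::
  "nat \<Rightarrow> nat \<Rightarrow> nat \<Rightarrow> nat set \<Rightarrow> (nat \<Rightarrow> nat \<Rightarrow> bool) \<Rightarrow> nat set \<Rightarrow> bool" where
  "gadget k a b V E X \<longleftrightarrow>
     finite V \<and> X \<subseteq> V \<and> k \<le> card V \<and> symp E \<and> irreflp E \<and> separable k E V \<and>
     (\<forall>v\<in>X. a \<le> card (neighbours E V v)) \<and>
     (\<forall>v\<in>V - X. b \<le> card (neighbours E V v))"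

lemma gadget_base: "\<exists>V E X. gadget k k (k + d) V E X \<and> card X = d + 1"
proof -
  define R P V where "R = {..<k}" and "P = {k..<k + d + 1}" and "V = {..<k + d + 1}"
  define E where "E = (\<lambda>u v :: nat. u \<noteq> v \<and> (u < k \<or> v < k))"
  have V: "V = {} \<union> R \<union> P" by (auto simp: V_def R_def P_def)
  have R: "neighbours E V v = V - {v}" if "v \<in> R" for v
    using that by (auto simp: neighbours_def E_def R_def)
  have P: "neighbours E V v = R" if "v \<in> P" for v
    using that by (auto simp: neighbours_def E_def R_def V_def P_def)
  have "separable k E V"
    unfolding V
  \<comment> \<open>The ports \<open>P\<close> are peeled off first, each seeing exactly the
    \<open>k\<close> vertices of \<open>R\<close>; what remains is \<open>R\<close>, where no degree
    exceeds \<open>k\<close>.\<close>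
  proof (intro separable_extend)
    show "card (neighbours E ({} \<union> R) r) \<le> k" for r
      using card_mono[OF _ neighbours_subset, of R E r] by (simp add: R_def)
    show "card (neighbours E ({} \<union> R \<union> P) p) \<le> k" if "p \<in> P" for p
      using P[OF that] unfolding V[symmetric] by (simp add: R_def)
  qed (auto simp: R_def P_def separable_empty)
  moreover have "card (neighbours E V v) = k + d" if "v \<in> V - P" for v
    using that R[of v] by (auto simp: V_def R_def P_def)
  moreover have "card (neighbours E V v) = k" if "v \<in> P" for v
    using P[OF that] by (simp add: R_def)
  moreover have "symp E" "irreflp E"
    by (auto simp: E_def symp_def irreflp_def)
  moreover have "finite V" "P \<subseteq> V" "k \<le> card V"
    by (auto simp: V_def P_def)
  ultimately have "gadget k k (k + d) V E P"
    by (simp add: gadget_def)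
  moreover have "card P = d + 1" by (simp add: P_def)
  ultimately show ?thesis by blast
qed

text \<open>The new ports are both copies of the old ports and of the \<open>q\<close> hubs. Old
  ports gain the \<open>q\<close> hubs; hubs have \<open>k\<close> neighbours in their own copy and
  \<open>s + q\<close> in the other. Both kinds reach \<open>k + (s + q)\<close>.\<close>

lemma gadget_step:
  assumes g: "gadget k (k + s) b V E X" and q: "2 * (q * (s + q)) \<le> k" "q > 0"
    and X: "card X \<le> k"
  shows "\<exists>V' E' X'. gadget k (k + (s + q)) b V' E' X' \<and> card X' = 2 * (card X + q)"
proof -
  have V: "finite V" "X \<subseteq> V" "k \<le> card V" and E: "symp E" "irreflp E" and sep: "separable k E V"
    and degX: "\<And>v. v \<in> X \<Longrightarrow> k + s \<le> card (neighbours E V v)"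
    and degV: "\<And>v. v \<in> V - X \<Longrightarrow> b \<le> card (neighbours E V v)"
    using g by (auto simp: gadget_def)
  \<comment> \<open>Containing \<open>X\<close> makes every port gain all hubs; size exactly
    \<open>k\<close> keeps the hubs peelable.\<close>
  obtain W where W: "X \<subseteq> W" "W \<subseteq> V" "card W = k"
    using exists_subset_between[OF X V(3) V(2) V(1)] by auto
  have "s + q \<le> q * (s + q)" using q(2) by simp
  then have "s + q \<le> card V" using q V(3) by linarith
  then obtain U where U: "U \<subseteq> V" "card U = s + q"
    by (meson obtain_subset_with_card_n)
  obtain m where m: "\<And>v. v \<in> V \<Longrightarrow> v < m"
    using V(1) finite_nat_set_iff_bounded by auto
  define P where "P = {m..<m + q}"
  have P: "finite P" "card P = q" "V \<inter> P = {}"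
    using m by (fastforce simp: P_def)+
  define E1 where "E1 = attach E V P W"
  define E' where "E' = doubled E1 P U"
  define V1 where "V1 = V \<union> P"
  have V1: "finite V1" "P \<subseteq> V1" "U \<subseteq> V1" using V P U by (auto simp: V1_def)
  have E1: "symp E1" "irreflp E1"
    using E P(3) W(2) by (auto simp: E1_def attach_def symp_def irreflp_def)
  have nP: "neighbours E1 V1 v = W" if "v \<in> P" for v
    unfolding E1_def V1_def using attach_neighbours(1) P(3) W(2) that .
  have nX: "k + (s + q) \<le> card (neighbours E1 V1 v)" if "v \<in> X" for v
  proof -
    have "neighbours E1 V1 v = neighbours E V v \<union> P"
      unfolding E1_def V1_def using attach_neighbours(2)[OF P(3) W(2)] that W(1) by auto
    moreover have "card (neighbours E V v \<union> P) = card (neighbours E V v) + card P"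
      using P V neighbours_subset[of E V v] by (intro card_Un_disjoint) auto
    ultimately show ?thesis using degX[OF that] P(2) by simp
  qed
  have nV: "b \<le> card (neighbours E1 V1 v)" if "v \<in> V - X" for v
  proof -
    have "neighbours E V v \<subseteq> neighbours E1 V1 v"
      using that by (auto simp: neighbours_def E1_def V1_def attach_def)
    from card_mono[OF _ this] show ?thesis using degV[OF that] V1(1) by simp
  qed
  have "separable k E1 V1"
    unfolding E1_def V1_def using sep V(1) P W by (intro separable_attach) auto
  then have "separable k E' (copies V1)"
    unfolding E'_def using V1 q U P by (intro separable_doubled) auto
  moreover have "symp E'" "irreflp E'"
    using E1 by (auto simp: E'_def doubled_def symp_def irreflp_def)
  moreover have "k + (s + q) \<le> card (neighbours E' (copies V1) x)" if "x \<in> copies (X \<union> P)" for x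
  proof (cases "x div 2 \<in> P")
    case True
    then show ?thesis
      using card_neighbours_doubled_hub[OF V1(1,3) True, of E1] nP W(3) U(2) by (simp add: E'_def)
  next
    case False
    then show ?thesis
      using that nX[of "x div 2"] card_neighbours_doubled[OF V1(1), of E1 x P U]
      by (simp add: E'_def)
  qed
  moreover have "b \<le> card (neighbours E' (copies V1) x)" if "x \<in> copies V1 - copies (X \<union> P)" for x
    using that nV[of "x div 2"] card_neighbours_doubled[OF V1(1), of E1 x P U]
    by (auto simp: E'_def V1_def)
  moreover have "k \<le> card (copies V1)"
    using V card_mono[of V1 V] V1(1) card_copies[OF V1(1)] by (auto simp: V1_def)
  ultimately have "gadget k (k + (s + q)) b (copies V1) E' (copies (X \<union> P))"
    using V V1(1) by (auto simp: gadget_def V1_def)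
  moreover have "card (X \<union> P) = card X + q"
    using P V by (subst card_Un_disjoint) (auto intro: finite_subset)
  moreover have "finite (X \<union> P)" using P(1) V finite_subset by auto
  then have "card (copies (X \<union> P)) = 2 * card (X \<union> P)" by (rule card_copies)
  ultimately show ?thesis by metis
qed

text \<open>The port count follows x -> 2(x + q), so \<open>card X + 2 * q\<close> doubles in each
  step. The hypothesis \<open>big\<close> keeps the count at most \<open>k\<close>
  throughout.\<close>

lemma gadget_iterate:
  assumes k: "k = 2 * L * q * q" and q: "q > 0" and big: "2 ^ L * (L * q + 1 + 2 * q) \<le> k"
    and "j \<le> L"
  shows "\<exists>V E X. gadget k (k + j * q) (k + L * q) V E X \<and>
           card X + 2 * q = 2 ^ j * (L * q + 1 + 2 * q)"
  using \<open>j \<le> L\<close>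
proof (induction j)
  case 0
  then show ?case using gadget_base[of k "L * q"] by auto
next
  case (Suc j)
  then obtain V E X where g: "gadget k (k + j * q) (k + L * q) V E X"
    and X: "card X + 2 * q = 2 ^ j * (L * q + 1 + 2 * q)" by auto
  have "(2::nat) ^ j * (L * q + 1 + 2 * q) \<le> 2 ^ L * (L * q + 1 + 2 * q)"
    using Suc.prems by (intro mult_le_mono1 power_increasing) auto
  then have "card X \<le> k" using X big by linarith
  \<comment> \<open>The cut between the copies is most expensive in the last step, where the bound
    equals \<open>k\<close>.\<close>
  moreover have "2 * q * (Suc j * q) \<le> 2 * q * (L * q)"
    using Suc.prems by (intro mult_le_mono) auto
  then have "2 * (q * (j * q + q)) \<le> k"
    unfolding k by (simp add: algebra_simps)
  ultimately obtain V' E' X' where "gadget k (k + (j * q + q)) (k + L * q) V' E' X'"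
    "card X' = 2 * (card X + q)"
    using gadget_step[OF g _ q] by auto
  moreover have "2 * (card X + q) + 2 * q = 2 ^ Suc j * (L * q + 1 + 2 * q)"
    using X by simp
  ultimately show ?case by (metis add.commute mult_Suc)
qed

section \<open>Transfer to pair graphs\<close>

definition graph_of :: "'a set \<Rightarrow> ('a \<Rightarrow> 'a \<Rightarrow> bool) \<Rightarrow> 'a pair_pre_digraph" where
  "graph_of V E = \<lparr>pverts = V, parcs = {(u, v). u \<in> V \<and> v \<in> V \<and> E u v}\<rparr>"

lemma pverts_graph_of [simp]: "pverts (graph_of V E) = V"
  by (simp add: graph_of_def)

lemma pair_graph_graph_of:
  assumes "finite V" "symp E" "irreflp E"
  shows "pair_graph (graph_of V E)"
proof
  show "finite (parcs (graph_of V E))"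
    by (rule finite_subset[of _ "V \<times> V"]) (use assms(1) in \<open>auto simp: graph_of_def\<close>)
qed (use assms in \<open>auto simp: graph_of_def symmetric_def sym_def symp_def irreflp_def\<close>)

lemma out_degree_graph_of:
  assumes "v \<in> V"
  shows "out_degree (with_proj (graph_of V E)) v = card (neighbours E V v)"
proof -
  have "out_arcs (with_proj (graph_of V E)) v = Pair v ` neighbours E V v"
    using assms by (auto simp: out_arcs_def graph_of_def neighbours_def)
  then show ?thesis by (simp add: out_degree_def card_image inj_on_def)
qed

text \<open>A cheap split of the vertex set of \<open>H\<close> is also cheap in \<open>H\<close>,
  whose arcs all satisfy \<open>E\<close>.\<close>

lemma separable_not_edge_connected:
  assumes sep: "separable k E V" and fin: "finite V"
    and H: "subgraph (with_proj H) (with_proj (graph_of V E))"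
  shows "\<not> edge_connected (k + 1) H"
proof
  assume conn: "edge_connected (k + 1) H"
  have sub: "pverts H \<subseteq> V" "parcs H \<subseteq> {(u, v). E u v}"
    using H by (auto simp: subgraph_def graph_of_def)
  have "2 \<le> card (pverts H)" using conn by (simp add: edge_connected_def)
  then obtain A B where AB: "A \<noteq> {}" "B \<noteq> {}" "A \<inter> B = {}" "A \<union> B = pverts H"
      "card (crossing E A B) \<le> k"
    using sep[unfolded separable_def, rule_format, OF sub(1)] by auto
  have "finite A" "finite B" using AB(4) sub(1) fin by (auto intro: finite_subset)
  then have "card (edges_between H A B) \<le> card (crossing E A B)"
    using sub(2) by (intro card_mono finite_crossing) (auto simp: edges_between_def crossing_def)
  moreover have "k + 1 \<le> card (edges_between H A B)"
    using conn[unfolded edge_connected_def] AB(1-4) by simp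
  ultimately show False using AB(5) by simp
qed

section \<open>Choice of the parameters\<close>

theorem theorem6:
  fixes C :: real
  shows "\<exists>(k::nat) (G :: nat pair_pre_digraph).
           k \<ge> 1 \<and>
           pair_graph G \<and> pverts G \<noteq> {} \<and>
           real (min_degree G) \<ge> real k + C * sqrt (real k) \<and>
           \<not> (\<exists>H :: nat pair_pre_digraph.
                 pair_graph H \<and> subgraph (with_proj H) (with_proj G) \<and> edge_connected (k + 1) H)"
proof -
  \<comment> \<open>\<open>nat\<close> sends negative values to 0, and \<open>Suc\<close> then
    ensures \<open>c \<ge> 1\<close>, hence \<open>k \<ge> 1\<close>.\<close>
  define c where "c = Suc (nat \<lceil>C\<rceil>)"
  have c: "C \<le> real c" "c \<ge> 1" unfolding c_def by linarith+
  \<comment> \<open>This makes \<open>k\<close> the square of \<open>2 * c * q\<close>, so that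
    \<open>L * q\<close> is exactly \<open>c\<close> times its root.\<close>
  define L where "L = 2 * c * c"
  \<comment> \<open>Since \<open>1 \<le> q\<close>, the port bound
    \<open>2 ^ L * (L * q + 1 + 2 * q)\<close> is at most \<open>q * q\<close>, hence at most
    \<open>k\<close>.\<close>
  define q :: nat where "q = 2 ^ L * (L + 3)"
  define k where "k = 2 * L * q * q"
  have pos: "L \<ge> 1" "q \<ge> 1" using c(2) by (auto simp: L_def q_def)
  have k: "k \<ge> 1" using pos by (simp add: k_def)
  have "2 ^ L * (L * q + 1 + 2 * q) \<le> 2 ^ L * (L * q + 3 * q)"
    using pos by (intro mult_le_mono2) simp
  also have "\<dots> = q * q" by (simp add: q_def algebra_simps)
  also have "\<dots> \<le> k" using pos by (simp add: k_def)
  \<comment> \<open>After \<open>L\<close> steps the ports have caught up: both degree bounds are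
    \<open>k + L * q\<close>.\<close>
  finally obtain V E X where g: "gadget k (k + L * q) (k + L * q) V E X"
    using gadget_iterate[OF k_def, of L] pos by auto
  have V: "finite V" "k \<le> card V" "symp E" "irreflp E" "separable k E V"
    and deg: "\<And>v. v \<in> V \<Longrightarrow> k + L * q \<le> card (neighbours E V v)"
    using g by (auto simp: gadget_def)
  have ne: "V \<noteq> {}" using V(2) k by auto
  have "k + L * q \<le> min_degree (graph_of V E)"
    unfolding min_degree_def using V(1) ne deg
    by (subst Min_ge_iff) (auto simp: out_degree_graph_of)
  moreover have "sqrt (real k) = 2 * real c * real q"
  proof -
    have "real k = (2 * real c * real q)\<^sup>2" by (simp add: k_def L_def power2_eq_square)
    then show ?thesis by simp
  qed
  then have "C * sqrt (real k) \<le> real (L * q)"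
    using mult_right_mono[OF c(1), of "2 * real c * real q"] by (simp add: L_def mult_ac)
  ultimately have "real k + C * sqrt (real k) \<le> real (min_degree (graph_of V E))"
    by linarith
  moreover have "pverts (graph_of V E) \<noteq> {}" using ne by simp
  ultimately show ?thesis
    using k pair_graph_graph_of[OF V(1,3,4)] separable_not_edge_connected[OF V(5,1)] by blast
qed

end
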